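(* Let $X$ be a set and $n$ a natural number. The operations $\vee$ and $\cap$ satisfy the absorption law on the collection $\mathfrak F^{(n)}_{\mathrm{fin}}(X)$ of $(n)$-fractoconvexities on $X$ with respect to finite sets of $n$-ary convexities: for all $\mathbf F_1,\mathbf F_2\in\mathfrak F^{(n)}_{\mathrm{fin}}(X)$, $$(\mathbf F_1\vee\mathbf F_2)\cap\mathbf F_1=\mathbf F_1,\qquad (\mathbf F_1\cap\mathbf F_2)\vee\mathbf F_1=\mathbf F_1.$$
   Context: A convexity on $X$ is a family $\mathbf G\subset 2^X$ such that $X\in\mathbf G$ and $\mathbf G$ is closed under arbitrary intersections of its elements. Its convex hull operator $\mathbf g$ sends $A\subset X$ to the intersection of all members of $\mathbf G$ containing $A$. The convexity $\mathbf G$ is $n$-ary if for every $A\subset X$: $A\in\mathbf G$ if and only if $\mathbf gB\subset A$ for all $B\subset A$ with $|B|\leqslant n$. The hull operator of $\mathbf G_\lambda$ is denoted $\mathbf g_\lambda$. Fractoconvexity: let $\Lambda\neq\emptyset$ be an index set, $\mathbf G_\lambda$ ($\lambda\in\Lambda$) convexities on $X$, $\{M_i\}$ a partition of $\Lambda$ into nonempty sets such that $\mathbf G_{\lambda_1}\neq\mathbf G_{\lambda_2}$ whenever $\lambda_1\neq\lambda_2$ lie in the same $M_i$, and $m_i$ cardinal numbers with $1\leqslant m_i\leqslant|M_i|$. Then $(n)\text{-}\bigvee_i\frac{m_i}{\{\mathbf G_\lambda,\lambda\in M_i\}}$ is the family of all $A\subset X$ such that for every $B\subset A$ with $|B|\leqslant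 n$ there exist $i$ and $\Omega\subset M_i$ with $|\Omega|=m_i$ and $\bigcup_{\lambda\in\Omega}\mathbf g_\lambda B\subset A$. The collection $\mathfrak F^{(n)}_{\mathrm{fin}}(X)$ consists of all such fractoconvexities with $\Lambda$ finite and all $\mathbf G_\lambda$ $n$-ary; each of its elements is considered together with a presentation of this form. Operation $\vee$: for $\mathbf F_j=(n)\text{-}\bigvee_i\frac{m_i^j}{\{\mathbf G_\lambda^j,\lambda\in M_i^j\}}$, $j\in\{1,2\}$ (with $\mathbf g^j_\lambda$ the hull operator of $\mathbf G^j_\lambda$), a set $A\subset X$ belongs to $\mathbf F_1\vee\mathbf F_2$ if and only if for every $B\subset A$ with $|B|\leqslant n$ there exist $j\in\{1,2\}$, $i$ and $\Omega\subset M_i^j$ with $|\Omega|=m_i^j$ and $\bigcup_{\lambda\in\Omega}\mathbf g_\lambda^jB\subset A$. Operation $\cap$: set-theoretic intersection of families of subsets of $X$. When $\mathbf F_1\cap\mathbf F_2$ occurs as an operand of $\vee$, it is taken with the presentation $\bigvee\frac{|S|}{S}$, where $S$ runs over all sets of convexities $S=\{\mathbf G^1_\lambda:\lambda\in\Omega_1\}\cup\{\mathbf G^2_\lambda:\lambda\in\Omega_2\}$ with $\Omega_1\subset M^1_{i}$, $|\Omega_1|=m^1_{i}$, $\Omega_2\subset M^2_{i'}$, $|\Omega_2|=m^2_{i'}$ for some $i,i'$; that is, the condition imposed on each $B\subset A$ with $|B|\leqslant n$ is that there exist such $i,\Omega_1,i',\Omega_2$ with $\bigcup_{\lambda\in\Omega_1}\mathbf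 g^1_\lambda B\cup\bigcup_{\lambda\in\Omega_2}\mathbf g^2_\lambda B\subset A$. *)

theory Defs
  imports HOL.Hull "HOL-Library.Disjoint_Sets"
begin

text \<open>Since \<open>X \<in> G\<close> is required separately, only nonempty intersections need to be considered
  (in HOL the empty intersection is the whole type rather than \<open>X\<close>).\<close>

definition convexity_on :: "'a set \<Rightarrow> 'a set set \<Rightarrow> bool" where
  "convexity_on X G \<longleftrightarrow>
     G \<subseteq> Pow X \<and> X \<in> G \<and> (\<forall>S. S \<subseteq> G \<and> S \<noteq> {} \<longrightarrow> \<Inter>S \<in> G)"

definition convex_hull_op :: "'a set set \<Rightarrow> 'a set \<Rightarrow> 'a set" where
  "convex_hull_op G A = (\<lambda>C. C \<in> G) hull A"

definition small_subsets :: "nat \<Rightarrow> 'a set \<Rightarrow> 'a set set" where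
  "small_subsets n A = {B. B \<subseteq> A \<and> finite B \<and> card B \<le> n}"

definition n_ary :: "nat \<Rightarrow> 'a set \<Rightarrow> 'a set set \<Rightarrow> bool" where
  "n_ary n X G \<longleftrightarrow>
     (\<forall>A. A \<subseteq> X \<longrightarrow> (A \<in> G \<longleftrightarrow> (\<forall>B \<in> small_subsets n A. convex_hull_op G B \<subseteq> A)))"

text \<open>A presentation consists of the index set \<open>\<Lambda>\<close>, the convexities \<open>G\<^sub>\<lambda>\<close>, the blocks \<open>M\<^sub>i\<close> and the
  numbers \<open>m\<^sub>i\<close>. The blocks of a partition are pairwise distinct, so they serve as their own
  labels \<open>i\<close>. Only finite \<open>\<Lambda>\<close> will be admitted, hence natural numbers suffice for the \<open>m\<^sub>i\<close>.\<close>

record ('l, 'a) presentation =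
  index_set :: "'l set"
  conv :: "'l \<Rightarrow> 'a set set"
  blocks :: "'l set set"
  weight :: "'l set \<Rightarrow> nat"

definition fin_presentations :: "nat \<Rightarrow> 'a set \<Rightarrow> ('l, 'a) presentation set" where
  "fin_presentations n X = {F.
     index_set F \<noteq> {} \<and> finite (index_set F) \<and>
     (\<forall>l \<in> index_set F. convexity_on X (conv F l) \<and> n_ary n X (conv F l)) \<and>
     partition_on (index_set F) (blocks F) \<and>
     (\<forall>M \<in> blocks F. inj_on (conv F) M \<and> 1 \<le> weight F M \<and> weight F M \<le> card M)}"

text \<open>The sets \<open>\<Omega>\<close> contained in some block \<open>M\<^sub>i\<close> and having \<open>m\<^sub>i\<close> elements.\<close>

definition selections :: "('l, 'a) presentation \<Rightarrow> 'l set set" where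
  "selections F = {\<Omega>. \<exists>M \<in> blocks F. \<Omega> \<subseteq> M \<and> card \<Omega> = weight F M}"

definition admits :: "('l, 'a) presentation \<Rightarrow> 'a set \<Rightarrow> 'a set \<Rightarrow> bool" where
  "admits F B A \<longleftrightarrow> (\<exists>\<Omega> \<in> selections F. (\<Union>l\<in>\<Omega>. convex_hull_op (conv F l) B) \<subseteq> A)"

definition fractoconvexity :: "nat \<Rightarrow> 'a set \<Rightarrow> ('l, 'a) presentation \<Rightarrow> 'a set set" where
  "fractoconvexity n X F = {A. A \<subseteq> X \<and> (\<forall>B \<in> small_subsets n A. admits F B A)}"

definition frac_join ::
  "nat \<Rightarrow> 'a set \<Rightarrow> ('l, 'a) presentation \<Rightarrow> ('k, 'a) presentation \<Rightarrow> 'a set set" where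
  "frac_join n X F1 F2 =
     {A. A \<subseteq> X \<and> (\<forall>B \<in> small_subsets n A. admits F1 B A \<or> admits F2 B A)}"

definition meet_sets ::
  "('l, 'a) presentation \<Rightarrow> ('k, 'a) presentation \<Rightarrow> 'a set set set set" where
  "meet_sets F1 F2 =
     {conv F1 ` \<Omega>1 \<union> conv F2 ` \<Omega>2 | \<Omega>1 \<Omega>2. \<Omega>1 \<in> selections F1 \<and> \<Omega>2 \<in> selections F2}"

text \<open>The presentation \<open>\<Or>\<^sub>S |S|/S\<close> of the intersection. Different sets \<open>S\<close> may share convexities
  whereas blocks must be disjoint, so the index set is the disjoint union of the sets \<open>S\<close>.\<close>

definition meet_presentation ::
  "('l, 'a) presentation \<Rightarrow> ('k, 'a) presentation
    \<Rightarrow> ('a set set set \<times> 'a set set, 'a) presentation" where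
  "meet_presentation F1 F2 =
     \<lparr> index_set = (SIGMA S : meet_sets F1 F2. S),
       conv = snd,
       blocks = (\<lambda>S. {S} \<times> S) ` meet_sets F1 F2,
       weight = card \<rparr>"

lemma finite_selections:
  assumes "F \<in> fin_presentations n X"
  shows "finite (selections F)"
    and "\<Omega> \<in> selections F \<Longrightarrow> finite \<Omega> \<and> \<Omega> \<noteq> {} \<and> \<Omega> \<subseteq> index_set F"
proof -
  have fin: "finite (index_set F)" and part: "partition_on (index_set F) (blocks F)"
    and w: "\<forall>M \<in> blocks F. 1 \<le> weight F M"
    using assms by (auto simp: fin_presentations_def)
  have sub: "\<Omega> \<subseteq> index_set F" if "\<Omega> \<in> selections F" for \<Omega>
    using that part by (auto simp: selections_def partition_on_def)
  then have "selections F \<subseteq> Pow (index_set F)"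
    by blast
  then show "finite (selections F)"
    using fin finite_subset by blast
  show "finite \<Omega> \<and> \<Omega> \<noteq> {} \<and> \<Omega> \<subseteq> index_set F" if "\<Omega> \<in> selections F"
    using that w sub[OF that] finite_subset[OF _ fin] by (auto simp: selections_def)
qed

lemma selections_nonempty:
  assumes "F \<in> fin_presentations n X"
  shows "selections F \<noteq> {}"
proof -
  have "blocks F \<noteq> {}"
    using assms by (auto simp: fin_presentations_def partition_on_def)
  then obtain M where M: "M \<in> blocks F" by blast
  then have "weight F M \<le> card M"
    using assms by (auto simp: fin_presentations_def)
  then obtain \<Omega> where "\<Omega> \<subseteq> M" "card \<Omega> = weight F M"
    by (metis obtain_subset_with_card_n)
  then show ?thesis
    using M by (auto simp: selections_def)
qed

lemma meet_sets_finite: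
  assumes "F1 \<in> fin_presentations n X" "F2 \<in> fin_presentations n X" "S \<in> meet_sets F1 F2"
  shows "finite S" and "S \<noteq> {}"
  using assms(3) finite_selections(2)[OF assms(1)] finite_selections(2)[OF assms(2)]
  by (auto simp: meet_sets_def)

lemma meet_presentation_in_fin_presentations:
  fixes F1 :: "('l, 'a) presentation" and F2 :: "('k, 'a) presentation"
  assumes F1: "F1 \<in> fin_presentations n X" and F2: "F2 \<in> fin_presentations n X"
  shows "meet_presentation F1 F2 \<in> fin_presentations n X"
proof -
  let ?S = "meet_sets F1 F2"
  have fin: "finite ?S"
  proof -
    have "?S = (\<lambda>(\<Omega>1, \<Omega>2). conv F1 ` \<Omega>1 \<union> conv F2 ` \<Omega>2) ` (selections F1 \<times> selections F2)"
      by (auto simp: meet_sets_def)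
    then show ?thesis
      using finite_selections(1)[OF F1] finite_selections(1)[OF F2] by simp
  qed
  have ne: "?S \<noteq> {}"
    using selections_nonempty[OF F1] selections_nonempty[OF F2] by (auto simp: meet_sets_def)
  note S = meet_sets_finite[OF F1 F2]
  have conv: "convexity_on X c \<and> n_ary n X c" if "S \<in> ?S" "c \<in> S" for S c
  proof -
    obtain \<Omega>1 \<Omega>2 where sel: "\<Omega>1 \<in> selections F1" "\<Omega>2 \<in> selections F2"
      and eq: "S = conv F1 ` \<Omega>1 \<union> conv F2 ` \<Omega>2"
      using \<open>S \<in> ?S\<close> by (auto simp: meet_sets_def)
    have "\<Omega>1 \<subseteq> index_set F1" "\<Omega>2 \<subseteq> index_set F2"
      using finite_selections(2)[OF F1 sel(1)] finite_selections(2)[OF F2 sel(2)] by auto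
    then have "c \<in> conv F1 ` index_set F1 \<or> c \<in> conv F2 ` index_set F2"
      using \<open>c \<in> S\<close> unfolding eq by blast
    moreover have "\<forall>l \<in> index_set F1. convexity_on X (conv F1 l) \<and> n_ary n X (conv F1 l)"
      "\<forall>l \<in> index_set F2. convexity_on X (conv F2 l) \<and> n_ary n X (conv F2 l)"
      using F1 F2 by (simp_all add: fin_presentations_def)
    ultimately show ?thesis
      by auto
  qed
  have ne': "(SIGMA S : ?S. S) \<noteq> {}"
    using ne S(2) by (simp add: Sigma_empty_iff)
  have part: "partition_on (SIGMA S : ?S. S) ((\<lambda>S. {S} \<times> S) ` ?S)"
    using S(2) by (auto simp: partition_on_def disjoint_def)
  have one: "1 \<le> card S" if "S \<in> ?S" for S
    using S[OF that] by (simp add: Suc_le_eq card_gt_0_iff)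
  have conv': "convexity_on X (snd p) \<and> n_ary n X (snd p)" if "p \<in> (SIGMA S : ?S. S)" for p
    using that conv by auto
  have weight: "inj_on snd M \<and> 1 \<le> card M \<and> card M \<le> card M"
    if "M \<in> (\<lambda>S. {S} \<times> S) ` ?S" for M
    using that one by (auto simp: card_cartesian_product inj_on_def)
  show ?thesis
    unfolding fin_presentations_def meet_presentation_def mem_Collect_eq presentation.simps
    using finite_SigmaI[OF fin S(1)] ne' conv' part weight by (intro conjI ballI) simp_all
qed

lemma fractoconvexity_meet_presentation:
  fixes F1 :: "('l, 'a) presentation" and F2 :: "('k, 'a) presentation"
  assumes F1: "F1 \<in> fin_presentations n X" and F2: "F2 \<in> fin_presentations n X"
  shows "fractoconvexity n X (meet_presentation F1 F2) =
           fractoconvexity n X F1 \<inter> fractoconvexity n X F2"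
proof -
  have sel: "selections (meet_presentation F1 F2) = (\<lambda>S. {S} \<times> S) ` meet_sets F1 F2"
  proof (intro equalityI subsetI)
    fix \<Omega> assume "\<Omega> \<in> selections (meet_presentation F1 F2)"
    then obtain S where S: "S \<in> meet_sets F1 F2" "\<Omega> \<subseteq> {S} \<times> S" "card \<Omega> = card ({S} \<times> S)"
      by (auto simp: selections_def meet_presentation_def)
    have "finite ({S} \<times> S)"
      using meet_sets_finite(1)[OF F1 F2 S(1)] by simp
    then have "\<Omega> = {S} \<times> S"
      using S(2,3) by (rule card_subset_eq)
    then show "\<Omega> \<in> (\<lambda>S. {S} \<times> S) ` meet_sets F1 F2"
      using S(1) by blast
  next
    fix \<Omega> assume "\<Omega> \<in> (\<lambda>S. {S} \<times> S) ` meet_sets F1 F2"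
    then show "\<Omega> \<in> selections (meet_presentation F1 F2)"
      by (auto simp: selections_def meet_presentation_def)
  qed
  have ms: "(\<exists>S \<in> meet_sets F1 F2. P S) \<longleftrightarrow>
      (\<exists>\<Omega>1 \<in> selections F1. \<exists>\<Omega>2 \<in> selections F2. P (conv F1 ` \<Omega>1 \<union> conv F2 ` \<Omega>2))" for P
    unfolding meet_sets_def by blast
  have un: "(\<Union>p \<in> {S} \<times> S. convex_hull_op (snd p) B) = (\<Union>c\<in>S. convex_hull_op c B)"
    for S :: "'a set set set" and B :: "'a set"
    by auto
  have "admits (meet_presentation F1 F2) B A \<longleftrightarrow> admits F1 B A \<and> admits F2 B A"
    for A B :: "'a set"
  proof -
    have "admits (meet_presentation F1 F2) B A \<longleftrightarrow>
            (\<exists>S \<in> meet_sets F1 F2. (\<Union>c\<in>S. convex_hull_op c B) \<subseteq> A)"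
      unfolding admits_def sel by (simp add: meet_presentation_def un)
    also have "\<dots> \<longleftrightarrow> (\<exists>\<Omega>1 \<in> selections F1. \<exists>\<Omega>2 \<in> selections F2.
        (\<Union>c \<in> conv F1 ` \<Omega>1 \<union> conv F2 ` \<Omega>2. convex_hull_op c B) \<subseteq> A)"
      by (rule ms)
    also have "\<dots> \<longleftrightarrow> admits F1 B A \<and> admits F2 B A"
      unfolding admits_def by (simp add: UN_Un)
    finally show ?thesis .
  qed
  then show ?thesis
    by (auto simp: fractoconvexity_def)
qed

end

theory Submission
  imports Defs
begin

text \<open>Both laws hold already pointwise, for the condition \<open>admits\<close> imposed on a single pair
  \<open>B \<subseteq> A\<close>. The join imposes the disjunction of the two conditions, so the first law is the
  absorption \<open>(p \<or> q) \<and> p \<longleftrightarrow> p\<close>. For the second law, a selection of the meet presentation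
  consists of the convexities in \<open>\<Omega>\<^sub>1\<close> and \<open>\<Omega>\<^sub>2\<close> for some selections \<open>\<Omega>\<^sub>1\<close> of \<open>F\<^sub>1\<close> and
  \<open>\<Omega>\<^sub>2\<close> of \<open>F\<^sub>2\<close>; forgetting \<open>\<Omega>\<^sub>2\<close> leaves fewer hulls to contain in \<open>A\<close>, so the condition of
  the meet implies that of \<open>F\<^sub>1\<close> (\<open>admits_meet_presentationD1\<close>), and the disjunction with the
  latter adds no sets. The equality of families
  \<open>fractoconvexity n X (meet_presentation F\<^sub>1 F\<^sub>2) = fractoconvexity n X F\<^sub>1 \<inter> fractoconvexity n X F\<^sub>2\<close>
  would not suffice: the join may use different operands for different \<open>B\<close>, so it depends on
  the presentations.\<close>

text \<open>A block of the meet presentation has weight equal to its cardinality, and it is finite, so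
  the only selection from it is the whole block.\<close>

lemma selections_meet_presentationE:
  assumes "F1 \<in> fin_presentations n X" and "F2 \<in> fin_presentations n X"
    and "\<Omega> \<in> selections (meet_presentation F1 F2)"
  obtains \<Omega>1 \<Omega>2 where "\<Omega>1 \<in> selections F1" and "\<Omega>2 \<in> selections F2"
    and "\<Omega> = {conv F1 ` \<Omega>1 \<union> conv F2 ` \<Omega>2} \<times> (conv F1 ` \<Omega>1 \<union> conv F2 ` \<Omega>2)"
proof -
  obtain S where S: "S \<in> meet_sets F1 F2" "\<Omega> \<subseteq> {S} \<times> S" "card \<Omega> = card ({S} \<times> S)"
    using assms(3) by (auto simp: selections_def meet_presentation_def)
  have "finite ({S} \<times> S)"
    using meet_sets_finite(1)[OF assms(1,2) S(1)] by simp
  then have "\<Omega> = {S} \<times> S"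
    using S(2,3) by (rule card_subset_eq)
  with S(1) show thesis
    using that by (auto simp: meet_sets_def)
qed

lemma admits_meet_presentationD1:
  assumes "F1 \<in> fin_presentations n X" and "F2 \<in> fin_presentations n X"
    and "admits (meet_presentation F1 F2) B A"
  shows "admits F1 B A"
proof -
  obtain \<Omega> where \<Omega>: "\<Omega> \<in> selections (meet_presentation F1 F2)"
    and hull: "(\<Union>p\<in>\<Omega>. convex_hull_op (snd p) B) \<subseteq> A"
    using assms(3) by (auto simp: admits_def meet_presentation_def)
  obtain \<Omega>1 \<Omega>2 where \<Omega>1: "\<Omega>1 \<in> selections F1"
    and eq: "\<Omega> = {conv F1 ` \<Omega>1 \<union> conv F2 ` \<Omega>2} \<times> (conv F1 ` \<Omega>1 \<union> conv F2 ` \<Omega>2)"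
    using selections_meet_presentationE[OF assms(1,2) \<Omega>] by metis
  have "(\<Union>l\<in>\<Omega>1. convex_hull_op (conv F1 l) B) \<subseteq> A"
    using hull unfolding eq UN_subset_iff by auto
  then show ?thesis
    using \<Omega>1 by (auto simp: admits_def)
qed

theorem mainTheorem4:
  fixes X :: "'a set" and n :: nat
    and F1 :: "('l, 'a) presentation" and F2 :: "('k, 'a) presentation"
  assumes "F1 \<in> fin_presentations n X" and "F2 \<in> fin_presentations n X"
  shows "frac_join n X F1 F2 \<inter> fractoconvexity n X F1 = fractoconvexity n X F1 \<and>
         frac_join n X (meet_presentation F1 F2) F1 = fractoconvexity n X F1"
proof
  show "frac_join n X F1 F2 \<inter> fractoconvexity n X F1 = fractoconvexity n X F1"
    by (auto simp: frac_join_def fractoconvexity_def)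
  show "frac_join n X (meet_presentation F1 F2) F1 = fractoconvexity n X F1"
    using admits_meet_presentationD1[OF assms]
    by (auto simp: frac_join_def fractoconvexity_def)
qed

end
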